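(* Let $G$ be a finite simple connected graph with $n$ vertices and $m$ edges. Then $$\begin{aligned}F(G^{--+})={}&3(m+3)F(G)-3(m+3)^2M_1(G)+6(m+3)M_2(G)-\xi_4(G)-3\,\mathrm{ReZG}_3(G)\\&+n(n-1)^3+m(m+3)^3.\end{aligned}$$
   Context: For a finite simple graph $H$ with vertex set $V(H)$ and edge set $E(H)$, $d_H(v)$ denotes the degree of the vertex $v$ in $H$. The F-index of $H$ is $F(H)=\sum_{v\in V(H)} d_H(v)^3$. The first and second Zagreb indices are $M_1(H)=\sum_{v\in V(H)} d_H(v)^2$ and $M_2(H)=\sum_{uv\in E(H)} d_H(u)d_H(v)$. Further, $\xi_4(H)=\sum_{v\in V(H)} d_H(v)^4=\sum_{uv\in E(H)}[d_H(u)^3+d_H(v)^3]$ and $\mathrm{ReZG}_3(H)=\sum_{uv\in E(H)} d_H(u)d_H(v)[d_H(u)+d_H(v)]$. For $x,y,z\in\{+,-\}$, the total transformation graph $G^{xyz}$ is the simple graph with vertex set $V(G)\cup E(G)$ (disjoint union) in which two distinct elements $u,v$ are adjacent if and only if one of the following holds: (i) $u,v\in V(G)$, and $u,v$ are adjacent in $G$ if $x=+$, respectively not adjacent in $G$ if $x=-$; (ii) $u,v\in E(G)$, and $u,v$ are adjacent in $G$ (share an endpoint) if $y=+$, respectively not adjacent in $G$ if $y=-$; (iii) one of them is a vertex of $G$ and the other is an edge of $G$, and they are incident in $G$ if $z=+$, respectively not incident in $G$ if $z=-$. *)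

theory Defs
  imports "Graph_Theory.Graph_Theory"
begin

text \<open>
  A finite simple graph is a \<^locale>\<open>pair_graph\<close>: a finite, loop-free, symmetric set of
  ordered pairs. Its undirected edges are the two-element sets below, each of which stems
  from two opposite arcs.
\<close>

definition uedges :: "'a pair_pre_digraph \<Rightarrow> 'a set set" where
  "uedges G = (\<lambda>(u, v). {u, v}) ` parcs G"

text \<open>By symmetry the degree of a vertex is its out-degree; see also \<open>deg_eq_card_uedges\<close>.\<close>

abbreviation deg :: "'a pair_pre_digraph \<Rightarrow> 'a \<Rightarrow> nat" where
  "deg G v \<equiv> out_degree (with_proj G) v"

definition F_index :: "'a pair_pre_digraph \<Rightarrow> nat" where
  "F_index G = (\<Sum>v\<in>pverts G. deg G v ^ 3)"

definition zagreb1 :: "'a pair_pre_digraph \<Rightarrow> nat" where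
  "zagreb1 G = (\<Sum>v\<in>pverts G. deg G v ^ 2)"

text \<open>In sums over an edge \<open>e = {u, v}\<close>, the product and the sum over \<open>w \<in> e\<close> are
  \<open>d(u) d(v)\<close> and \<open>d(u) + d(v)\<close>.\<close>

definition zagreb2 :: "'a pair_pre_digraph \<Rightarrow> nat" where
  "zagreb2 G = (\<Sum>e\<in>uedges G. \<Prod>w\<in>e. deg G w)"

definition xi4 :: "'a pair_pre_digraph \<Rightarrow> nat" where
  "xi4 G = (\<Sum>v\<in>pverts G. deg G v ^ 4)"

definition ReZG3 :: "'a pair_pre_digraph \<Rightarrow> nat" where
  "ReZG3 G = (\<Sum>e\<in>uedges G. (\<Prod>w\<in>e. deg G w) * (\<Sum>w\<in>e. deg G w))"

datatype sign = Plus | Minus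

fun signed :: "sign \<Rightarrow> bool \<Rightarrow> bool" where
  "signed Plus P \<longleftrightarrow> P"
| "signed Minus P \<longleftrightarrow> \<not> P"

fun total_adj :: "sign \<Rightarrow> sign \<Rightarrow> sign \<Rightarrow> 'a pair_pre_digraph \<Rightarrow>
    'a + 'a set \<Rightarrow> 'a + 'a set \<Rightarrow> bool" where
  "total_adj x y z G (Inl u) (Inl v) \<longleftrightarrow> u \<noteq> v \<and> signed x ((u, v) \<in> parcs G)"
| "total_adj x y z G (Inr e) (Inr f) \<longleftrightarrow> e \<noteq> f \<and> signed y (e \<inter> f \<noteq> {})"
| "total_adj x y z G (Inl v) (Inr e) \<longleftrightarrow> signed z (v \<in> e)"
| "total_adj x y z G (Inr e) (Inl v) \<longleftrightarrow> signed z (v \<in> e)"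

definition total_transformation ::
    "sign \<Rightarrow> sign \<Rightarrow> sign \<Rightarrow> 'a pair_pre_digraph \<Rightarrow> ('a + 'a set) pair_pre_digraph" where
  "total_transformation x y z G =
     \<lparr> pverts = pverts G <+> uedges G,
       parcs = {(a, b). a \<in> pverts G <+> uedges G \<and> b \<in> pverts G <+> uedges G \<and>
                        total_adj x y z G a b} \<rparr>"

lemma (in pair_graph) finite_uedges: "finite (uedges G)"
  unfolding uedges_def using pair_finite_arcs by simp

lemma (in pair_graph) deg_eq_card_uedges: "deg G v = card {e \<in> uedges G. v \<in> e}"
proof -
  have "{e \<in> uedges G. v \<in> e} = (\<lambda>(u, w). {u, w}) ` out_arcs (with_proj G) v"
    using pair_sym_arcs
    by (fastforce simp: uedges_def out_arcs_def symmetric_def arcs_ends_conv insert_commute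
        dest: symD)
  moreover have "inj_on (\<lambda>(u, w). {u, w}) (out_arcs (with_proj G) v)"
    by (auto simp: inj_on_def out_arcs_def doubleton_eq_iff)
  ultimately show ?thesis
    by (simp add: out_degree_def card_image)
qed

lemma total_adj_sym:
  assumes "sym (parcs G)" "total_adj x y z G a b"
  shows "total_adj x y z G b a"
proof -
  have "(u, v) \<in> parcs G \<longleftrightarrow> (v, u) \<in> parcs G" for u v
    using assms(1) by (auto dest: symD)
  then show ?thesis
    using assms(2) by (cases a; cases b) (auto simp: Int_commute)
qed

lemma (in pair_graph) pair_graph_total_transformation:
  "pair_graph (total_transformation x y z G)" (is "pair_graph ?T")
proof
  have fin: "finite (pverts ?T)"
    using pair_finite_verts finite_uedges by (simp add: total_transformation_def)
  then show "finite (pverts ?T)" .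
  have "parcs ?T \<subseteq> pverts ?T \<times> pverts ?T"
    by (auto simp: total_transformation_def)
  with fin show "finite (parcs ?T)"
    by (meson finite_SigmaI finite_subset)
  have "sym (parcs G)"
    using pair_sym_arcs by (simp add: symmetric_def arcs_ends_conv)
  then show "symmetric (with_proj ?T)"
    by (auto simp: symmetric_def arcs_ends_conv sym_def total_transformation_def
        intro: total_adj_sym)
  fix e assume e: "e \<in> parcs ?T"
  then show "fst e \<in> pverts ?T" "snd e \<in> pverts ?T"
    by (auto simp: total_transformation_def)
  show "fst e \<noteq> snd e"
    using e by (auto simp: total_transformation_def)
qed

end

theory Submission
  imports Defs
begin

text \<open>
  In \<open>G\<^sup>-\<^sup>-\<^sup>+\<close> every vertex \<open>v\<close> of \<open>G\<close> has degree \<open>(n - 1 - d(v)) + d(v) = n - 1\<close>. An edge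
  \<open>e = uv\<close> shares an endpoint with \<open>d(u) + d(v) - 1\<close> edges, itself included, and contains two
  vertices, so its degree is \<open>m + 3 - (d(u) + d(v))\<close>. Expanding the cube of the latter and
  double counting incident pairs of vertices and edges yields the formula.
\<close>

lemma out_degree_with_proj:
  "out_degree (with_proj G) v = card {w. (v, w) \<in> parcs G}"
proof -
  have "out_arcs (with_proj G) v = Pair v ` {w. (v, w) \<in> parcs G}"
    by (auto simp: out_arcs_def)
  then show ?thesis
    by (simp add: out_degree_def card_image inj_on_def)
qed

context pair_graph
begin

lemma uedgesE:
  assumes "e \<in> uedges G"
  obtains u v where "e = {u, v}" "u \<noteq> v" "u \<in> pverts G" "v \<in> pverts G"
proof -
  from assms obtain u v where "e = {u, v}" "(u, v) \<in> parcs G"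
    by (auto simp: uedges_def)
  with that show thesis
    using wellformed[of "(u, v)"] no_loops[of "(u, v)"] by simp
qed

text \<open>Double counting of incident pairs: a vertex \<open>v\<close> lies in
  \<open>deg G v\<close> edges, so its term \<open>g v\<close> occurs that often. Used below with
  \<open>g\<close> the first, second and third power of the degree.\<close>

lemma sum_uedges_sum_endpoints:
  fixes g :: "'a \<Rightarrow> 'b::comm_semiring_1"
  shows "(\<Sum>e\<in>uedges G. \<Sum>w\<in>e. g w) = (\<Sum>v\<in>pverts G. of_nat (deg G v) * g v)"
proof -
  \<comment> \<open>All endpoints are vertices, so the restriction changes nothing; it makes the
    inner index set a filter of a fixed set, as exchanging the sums requires.\<close>
  have "(\<Sum>e\<in>uedges G. \<Sum>w\<in>e. g w) = (\<Sum>e\<in>uedges G. \<Sum>w\<in>{w \<in> pverts G. w \<in> e}. g w)"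
    by (intro sum.cong refl) (auto elim!: uedgesE)
  also have "\<dots> = (\<Sum>v\<in>pverts G. \<Sum>e\<in>{e \<in> uedges G. v \<in> e}. g v)"
    by (rule sum.swap_restrict) (use finite_uedges pair_finite_verts in auto)
  finally show ?thesis
    by (simp add: deg_eq_card_uedges)
qed

text \<open>Inclusion-exclusion for the edges at \<open>u\<close> and the edges at \<open>v\<close>,
  where \<open>e = {u, v}\<close>: only \<open>e\<close> lies in both families, which gives the
  \<open>+ 1\<close>. The additive form avoids truncated subtraction.\<close>

lemma card_uedges_disjoint:
  assumes "e \<in> uedges G"
  shows "card {f \<in> uedges G. e \<inter> f = {}} + (\<Sum>w\<in>e. deg G w) = card (uedges G) + 1"
proof -
  from assms obtain u v where e: "e = {u, v}" and "u \<noteq> v"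
    by (rule uedgesE)
  define A where "A = (\<lambda>w. {f \<in> uedges G. w \<in> f})"
  define D where "D = {f \<in> uedges G. e \<inter> f = {}}"
  have fin: "finite (A w)" "finite D" for w
    using finite_uedges by (auto simp: A_def D_def)
  have "f = e" if "f \<in> uedges G" "u \<in> f" "v \<in> f" for f
    using that(1)
  proof (rule uedgesE)
    fix x y assume "f = {x, y}"
    with that(2,3) \<open>u \<noteq> v\<close> show "f = e"
      unfolding e by blast
  qed
  then have "A u \<inter> A v = {e}"
    using assms e unfolding A_def by blast
  with fin have "card (A u) + card (A v) = card (A u \<union> A v) + 1"
    by (simp add: card_Un_Int)
  moreover have "uedges G = D \<union> (A u \<union> A v)" "D \<inter> (A u \<union> A v) = {}"
    using e by (auto simp: A_def D_def)
  with fin have "card (uedges G) = card D + card (A u \<union> A v)"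
    by (simp add: card_Un_disjoint)
  moreover have "(\<Sum>w\<in>e. deg G w) = card (A u) + card (A v)"
    using e \<open>u \<noteq> v\<close> by (simp add: deg_eq_card_uedges A_def)
  ultimately show ?thesis
    by (simp add: D_def)
qed

lemma deg_mmp_Inl:
  assumes "v \<in> pverts G"
  shows "deg (total_transformation Minus Minus Plus G) (Inl v) = card (pverts G) - 1"
proof -
  define N where "N = {w. (v, w) \<in> parcs G}"
  have N: "N \<subseteq> pverts G - {v}"
    using wellformed no_loops by (fastforce simp: N_def)
  have "{b. (Inl v, b) \<in> parcs (total_transformation Minus Minus Plus G)}
      = (pverts G - {v} - N) <+> {e \<in> uedges G. v \<in> e}"
    using assms by (auto simp: total_transformation_def N_def)
  \<comment> \<open>The neighbours in \<open>N\<close> that \<open>v\<close> loses are made up for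
    by equally many incident edges.\<close>
  moreover have "card (pverts G - {v} - N) + card N = card (pverts G - {v})"
    using N pair_finite_verts
    by (metis card_Diff_subset card_mono finite_Diff finite_subset le_add_diff_inverse2)
  ultimately show ?thesis
    using assms pair_finite_verts finite_uedges
    by (simp add: out_degree_with_proj card_Plus deg_eq_card_uedges[symmetric] flip: N_def)
qed

text \<open>The 3 is made up of the two endpoints of \<open>e\<close> and the \<open>+ 1\<close> of
  \<open>card_uedges_disjoint\<close>.\<close>

lemma deg_mmp_Inr:
  assumes "e \<in> uedges G"
  shows "deg (total_transformation Minus Minus Plus G) (Inr e) + (\<Sum>w\<in>e. deg G w)
    = card (uedges G) + 3"
proof -
  from assms obtain u v where e: "e = {u, v}" "u \<noteq> v" "u \<in> pverts G" "v \<in> pverts G"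
    by (rule uedgesE)
  \<comment> \<open>The condition \<open>e \<noteq> f\<close> is absorbed by disjointness, since
    \<open>e\<close> is nonempty.\<close>
  have "{b. (Inr e, b) \<in> parcs (total_transformation Minus Minus Plus G)}
      = e <+> {f \<in> uedges G. e \<inter> f = {}}"
    using assms e by (auto simp: total_transformation_def)
  moreover have "finite e" "card e = 2"
    using e by auto
  ultimately show ?thesis
    using card_uedges_disjoint[OF assms] finite_uedges
    by (simp add: out_degree_with_proj card_Plus)
qed

lemma sum_uedges_deg_sum:
  "(\<Sum>e\<in>uedges G. \<Sum>w\<in>e. deg G w) = zagreb1 G"
  using sum_uedges_sum_endpoints[of "deg G"]
  by (simp add: zagreb1_def power2_eq_square)

text \<open>With a and b the degrees of the ends, (a + b)^2 = a^2 + b^2 + 2ab; by double counting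
  the pure squares sum to the third powers of the degrees.\<close>

lemma sum_uedges_deg_sum_squared:
  "(\<Sum>e\<in>uedges G. (\<Sum>w\<in>e. deg G w)\<^sup>2) = F_index G + 2 * zagreb2 G"
proof -
  have "(\<Sum>w\<in>e. deg G w)\<^sup>2 = (\<Sum>w\<in>e. deg G w ^ 2) + 2 * (\<Prod>w\<in>e. deg G w)"
    if "e \<in> uedges G" for e
    using that by (elim uedgesE) (simp add: power2_eq_square algebra_simps)
  then have "(\<Sum>e\<in>uedges G. (\<Sum>w\<in>e. deg G w)\<^sup>2)
      = (\<Sum>e\<in>uedges G. \<Sum>w\<in>e. deg G w ^ 2) + 2 * zagreb2 G"
    by (simp add: sum.distrib sum_distrib_left zagreb2_def)
  then show ?thesis
    using sum_uedges_sum_endpoints[of "\<lambda>w. deg G w ^ 2"]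
    by (simp add: F_index_def power2_eq_square power3_eq_cube mult.assoc)
qed

text \<open>Likewise from (a + b)^3 = a^3 + b^3 + 3ab(a + b), with the pure cubes summing to fourth
  powers.\<close>

lemma sum_uedges_deg_sum_cubed:
  "(\<Sum>e\<in>uedges G. (\<Sum>w\<in>e. deg G w) ^ 3) = xi4 G + 3 * ReZG3 G"
proof -
  have "(\<Sum>w\<in>e. deg G w) ^ 3
      = (\<Sum>w\<in>e. deg G w ^ 3) + 3 * ((\<Prod>w\<in>e. deg G w) * (\<Sum>w\<in>e. deg G w))"
    if "e \<in> uedges G" for e
    using that by (elim uedgesE) (simp add: power3_eq_cube algebra_simps)
  then have "(\<Sum>e\<in>uedges G. (\<Sum>w\<in>e. deg G w) ^ 3)
      = (\<Sum>e\<in>uedges G. \<Sum>w\<in>e. deg G w ^ 3) + 3 * ReZG3 G"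
    by (simp add: sum.distrib sum_distrib_left ReZG3_def)
  then show ?thesis
    using sum_uedges_sum_endpoints[of "\<lambda>w. deg G w ^ 3"]
    by (simp add: xi4_def power3_eq_cube power4_eq_xxxx mult.assoc)
qed

end

theorem theorem5:
  fixes G :: "'a pair_pre_digraph" and n m :: nat
  assumes "pair_graph G"
    and "connected (with_proj G)"
    and "card (pverts G) = n"
    and "card (uedges G) = m"
  shows "int (F_index (total_transformation Minus Minus Plus G)) =
      3 * (int m + 3) * int (F_index G)
    - 3 * (int m + 3)^2 * int (zagreb1 G)
    + 6 * (int m + 3) * int (zagreb2 G)
    - int (xi4 G)
    - 3 * int (ReZG3 G)
    + int n * (int n - 1)^3
    + int m * (int m + 3)^3"
proof -
  interpret pair_graph G by fact
  let ?T = "total_transformation Minus Minus Plus G"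
  define s where "s = (\<lambda>e. \<Sum>w\<in>e. deg G w)"
  have verts: "(\<Sum>v\<in>pverts G. int (deg ?T (Inl v)) ^ 3) = int n * (int n - 1) ^ 3"
  \<comment> \<open>The truncated \<open>n - 1\<close> agrees with \<open>int n - 1\<close> only for
    positive \<open>n\<close>; for \<open>n = 0\<close> both sides vanish.\<close>
  proof (cases "n = 0")
    case False
    then have "(\<Sum>v\<in>pverts G. int (deg ?T (Inl v)) ^ 3) = (\<Sum>v\<in>pverts G. (int n - 1) ^ 3)"
      using assms(3) by (intro sum.cong) (auto simp: deg_mmp_Inl)
    then show ?thesis
      using assms(3) by simp
  qed (use assms(3) pair_finite_verts in simp)
  \<comment> \<open>The powers of \<open>s e\<close> stay inside \<open>int\<close>, so that summing
    yields casts of the three natural-number sums evaluated above.\<close>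
  have cube: "int (deg ?T (Inr e)) ^ 3 = (int m + 3) ^ 3 - 3 * (int m + 3)\<^sup>2 * int (s e)
      + 3 * (int m + 3) * int (s e ^ 2) - int (s e ^ 3)" if "e \<in> uedges G" for e
  proof -
    have "int (deg ?T (Inr e)) = (int m + 3) - int (s e)"
      using deg_mmp_Inr[OF that] unfolding s_def assms(4) by linarith
    moreover have "(x - y) ^ 3 = x ^ 3 - 3 * x\<^sup>2 * y + 3 * x * y ^ 2 - y ^ 3" for x y :: int
      by (simp add: power2_eq_square power3_eq_cube algebra_simps)
    ultimately show ?thesis
      by (simp only: of_nat_power)
  qed
  have "(\<Sum>e\<in>uedges G. int (deg ?T (Inr e)) ^ 3)
      = (\<Sum>e\<in>uedges G. (int m + 3) ^ 3 - 3 * (int m + 3)\<^sup>2 * int (s e)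
          + 3 * (int m + 3) * int (s e ^ 2) - int (s e ^ 3))"
    by (rule sum.cong[OF refl cube])
  also have "\<dots> = int m * (int m + 3) ^ 3 - 3 * (int m + 3)\<^sup>2 * int (\<Sum>e\<in>uedges G. s e)
      + 3 * (int m + 3) * int (\<Sum>e\<in>uedges G. s e ^ 2) - int (\<Sum>e\<in>uedges G. s e ^ 3)"
    using assms(4)
    by (simp only: sum.distrib sum_subtractf sum_distrib_left of_nat_sum sum_constant)
  finally have edges: "(\<Sum>e\<in>uedges G. int (deg ?T (Inr e)) ^ 3) = \<dots>" .
  have "int (F_index ?T) = (\<Sum>v\<in>pverts G. int (deg ?T (Inl v)) ^ 3)
      + (\<Sum>e\<in>uedges G. int (deg ?T (Inr e)) ^ 3)"
    using pair_finite_verts finite_uedges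
    by (simp add: F_index_def sum.Plus total_transformation_def)
  then show ?thesis
    unfolding verts edges s_def
      sum_uedges_deg_sum sum_uedges_deg_sum_squared sum_uedges_deg_sum_cubed
    by (simp add: algebra_simps)
qed

end
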